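(* Let $n,k$ be positive integers, let $1<c<1+\frac{1}{4k}$, let $B$ be the block size and $1\le\alpha\le B$. For sufficiently large dimension $d=O(k\log(n/k))$, any indexing scheme for $(c,k)$-NN on $n$-point sets in $d$-dimensional Hamming space $\{0,1\}^d$ whose worst-case query time is $\lceil k/\alpha\rceil$ I/Os must, for some $n$-point set $P$, use $\Omega\!\left(\left(\frac{1}{2e}\sqrt{\frac{n\alpha}{kB}}\right)^{\alpha}\right)$ blocks of space.
   Context: Hamming distance on $\{0,1\}^d$: number of coordinates in which two vectors differ. $(c,k)$-NN problem: given a metric space, a set $P$ with $|P|=n$, an integer $1\le k\le n$ and $c>1$, a query $q$ must be answered by a set of $k$ points of $P$, each at distance at most $c$ times the distance from $q$ to its $k$-th nearest neighbor in $P$. Indexing scheme (indexability model): for a point set $P$ and block size $B$, a collection $\mathcal{B}$ of blocks, each a subset of $P$ of at most $B$ points, possibly depending on $c,k$; space usage is $|\mathcal{B}|$; the query time for $q$ is the minimum number of blocks whose union contains a valid answer to $q$; worst-case query time is the maximum over all queries $q\in\{0,1\}^d$.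
   Formalization: The formal theorem adds α ≤ 2k (for α > 2k the claim is false, e.g. k = 1, α = B = 3, where ⌈n/3⌉ blocks suffice) and reads log(n/k) in the dimension bound as max(1, log₂(n/k)), since for n = k > 1 the literal bound gives d = 0. *)

theory Defs
  imports Complex_Main "HOL-Library.Multiset" "HOL-Library.Extended_Nat"
begin

(* {0,1}^d is encoded by the Boolean lists of length d, because d has to be quantified
   inside the statement. *)
definition cube :: "nat \<Rightarrow> bool list set" where
  "cube d = {x. length x = d}"

(* Only meaningful for lists of equal length. *)
definition hamming :: "bool list \<Rightarrow> bool list \<Rightarrow> real" where
  "hamming x y = real (card {i. i < length x \<and> x ! i \<noteq> y ! i})"

(* The k-th smallest entry of the list of distances from q to the points of P, counted with
   multiplicity; meaningful for finite P and 1 <= k <= card P. *)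
definition kth_nn_dist :: "('a \<Rightarrow> 'a \<Rightarrow> real) \<Rightarrow> nat \<Rightarrow> 'a set \<Rightarrow> 'a \<Rightarrow> real" where
  "kth_nn_dist \<delta> k P q =
     sorted_list_of_multiset (image_mset (\<lambda>p. \<delta> q p) (mset_set P)) ! (k - 1)"

definition nn_answer ::
  "('a \<Rightarrow> 'a \<Rightarrow> real) \<Rightarrow> real \<Rightarrow> nat \<Rightarrow> 'a set \<Rightarrow> 'a \<Rightarrow> 'a set \<Rightarrow> bool" where
  "nn_answer \<delta> c k P q A \<longleftrightarrow>
     A \<subseteq> P \<and> card A = k \<and> (\<forall>a\<in>A. \<delta> q a \<le> c * kth_nn_dist \<delta> k P q)"

definition block_collection :: "nat \<Rightarrow> 'a set \<Rightarrow> 'a set set \<Rightarrow> bool" where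
  "block_collection B P \<B> \<longleftrightarrow> (\<forall>b\<in>\<B>. b \<subseteq> P \<and> card b \<le> B)"

(* The infimum is attained unless no subcollection covers a valid answer, in which case
   it is \<infinity>. *)
definition query_time ::
  "('a \<Rightarrow> 'a \<Rightarrow> real) \<Rightarrow> real \<Rightarrow> nat \<Rightarrow> 'a set \<Rightarrow> 'a set set \<Rightarrow> 'a \<Rightarrow> enat" where
  "query_time \<delta> c k P \<B> q =
     Inf {enat (card S) | S. S \<subseteq> \<B> \<and> finite S \<and> (\<exists>A. nn_answer \<delta> c k P q A \<and> A \<subseteq> \<Union> S)}"

definition worst_query_time ::
  "('a \<Rightarrow> 'a \<Rightarrow> real) \<Rightarrow> 'a set \<Rightarrow> real \<Rightarrow> nat \<Rightarrow> 'a set \<Rightarrow> 'a set set \<Rightarrow> enat" where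
  "worst_query_time \<delta> Q c k P \<B> = (SUP q\<in>Q. query_time \<delta> c k P \<B> q)"

definition point_sets :: "nat \<Rightarrow> nat \<Rightarrow> bool list set set" where
  "point_sets n d = {P. P \<subseteq> cube d \<and> card P = n}"

(* An indexing scheme assigns a block collection to every n-point set P; the same time
   bound t has to hold for all P and all queries. *)
definition hamming_indexing_scheme ::
  "nat \<Rightarrow> nat \<Rightarrow> real \<Rightarrow> nat \<Rightarrow> nat \<Rightarrow> nat \<Rightarrow> (bool list set \<Rightarrow> bool list set set) \<Rightarrow> bool" where
  "hamming_indexing_scheme n d c k B t I \<longleftrightarrow>
     (\<forall>P\<in>point_sets n d. block_collection B P (I P) \<and>
        worst_query_time hamming (cube d) c k P (I P) \<le> enat t)"

end

theory Submission
  imports Defs "HOL-Analysis.Convex" "HOL-Library.Disjoint_Sets"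
begin

text \<open>
  Split the coordinates into \<open>k\<close> segments of length \<open>O(log (n/k))\<close> and take a constant-weight code
  of more than \<open>n/k\<close> words and linear minimum distance for one segment (Gilbert-Varshamov). The
  points of group \<open>i\<close> carry a codeword in segment \<open>i\<close> and are zero elsewhere. The query that
  concatenates one codeword per segment has the corresponding transversal of the groups as its only
  valid answer, as all other points are farther by a factor of at least \<open>1 + 1/(4k)\<close>. By AM-GM,
  \<open>t\<close> blocks contain at most \<open>(t B / k)^k\<close> transversals, so \<open>M\<close> blocks with query time \<open>t\<close> cover at
  most \<open>M^t (t B / k)^k\<close> of them, while there are at least \<open>\<lfloor>n/k\<rfloor>^k\<close>.
\<close>

section \<open>Codes\<close>

definition small_subsets :: "'a set \<Rightarrow> nat \<Rightarrow> 'a set set" where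
  "small_subsets U r = {X. X \<subseteq> U \<and> card X < r}"

lemma finite_small_subsets: "finite U \<Longrightarrow> finite (small_subsets U r)"
  by (simp add: small_subsets_def)

lemma card_small_subsets_mult_power_le:
  fixes b :: nat
  assumes "finite U" "1 \<le> b"
  shows "card (small_subsets U r) * b ^ (card U - r) \<le> (1 + b) ^ card U"
proof -
  have "card (small_subsets U r) * b ^ (card U - r) = (\<Sum>X\<in>small_subsets U r. b ^ (card U - r))"
    by simp
  also have "\<dots> \<le> (\<Sum>X\<in>small_subsets U r. b ^ card (U - X))"
  proof (rule sum_mono)
    fix X assume "X \<in> small_subsets U r"
    then have "card (U - X) = card U - card X" "card X < r"
      using \<open>finite U\<close> by (auto simp: small_subsets_def card_Diff_subset finite_subset)
    then show "b ^ (card U - r) \<le> b ^ card (U - X)"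
      using \<open>1 \<le> b\<close> by (intro power_increasing) auto
  qed
  also have "\<dots> \<le> (\<Sum>X\<in>Pow U. b ^ card (U - X))"
    using \<open>finite U\<close> by (intro sum_mono2) (auto simp: small_subsets_def)
  also have "\<dots> = (\<Prod>x\<in>U. 1 + b)"
    by (subst prod_add) (simp_all only: \<open>finite U\<close> prod_constant power_one mult_1)
  finally show ?thesis
    by simp
qed

definition min_distance_code :: "'a set \<Rightarrow> nat \<Rightarrow> 'a set set \<Rightarrow> bool" where
  "min_distance_code U r C \<longleftrightarrow>
     C \<subseteq> Pow U \<and> pairwise (\<lambda>X Y. r \<le> card (sym_diff X Y)) C"

lemma min_distance_code_extend:
  assumes "finite U" "0 < r" and code: "min_distance_code U r C"
    and few: "card C * card (small_subsets U r) < 2 ^ card U"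
  obtains Y where "Y \<notin> C" "min_distance_code U r (insert Y C)"
proof -
  let ?V = "small_subsets U r"
  let ?balls = "\<Union>X\<in>C. sym_diff X ` ?V"
  have "finite ?V" and "finite C"
    using \<open>finite U\<close> code
    by (auto simp: finite_small_subsets min_distance_code_def intro: finite_subset)
  have "card ?balls \<le> (\<Sum>X\<in>C. card (sym_diff X ` ?V))"
    by (rule card_UN_le[OF \<open>finite C\<close>])
  also have "\<dots> \<le> (\<Sum>X\<in>C. card ?V)"
    by (intro sum_mono card_image_le \<open>finite ?V\<close>)
  also have "\<dots> < card (Pow U)"
    using few \<open>finite U\<close> by (simp add: card_Pow)
  finally have "\<not> Pow U \<subseteq> ?balls"
    using \<open>finite ?V\<close> \<open>finite C\<close> card_mono[of ?balls "Pow U"] by fastforce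
  then obtain Y where "Y \<subseteq> U" "Y \<notin> ?balls"
    by blast
  have far: "r \<le> card (sym_diff X Y)" if "X \<in> C" for X
  proof (rule ccontr)
    assume "\<not> r \<le> card (sym_diff X Y)"
    moreover have "X \<subseteq> U"
      using that code by (auto simp: min_distance_code_def)
    ultimately have "sym_diff X Y \<in> ?V"
      using \<open>Y \<subseteq> U\<close> by (auto simp: small_subsets_def)
    moreover have "Y = sym_diff X (sym_diff X Y)"
      by blast
    ultimately show False
      using \<open>Y \<notin> ?balls\<close> that by blast
  qed
  show thesis
  proof
    show "Y \<notin> C"
      using far[of Y] \<open>0 < r\<close> by auto
    show "min_distance_code U r (insert Y C)"
      using code far \<open>Y \<subseteq> U\<close> by (auto simp: min_distance_code_def pairwise_insert Un_commute)
  qed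
qed

lemma gilbert_varshamov:
  assumes "finite U" "0 < r" "N * card (small_subsets U r) \<le> 2 ^ card U"
  obtains C where "min_distance_code U r C" "card C = N"
proof -
  have "\<exists>C. min_distance_code U r C \<and> finite C \<and> card C = N"
    using assms(3)
  proof (induction N)
    case 0
    show ?case
      by (intro exI[of _ "{}"]) (simp add: min_distance_code_def)
  next
    case (Suc N)
    have "{} \<in> small_subsets U r"
      using \<open>0 < r\<close> by (simp add: small_subsets_def)
    then have "0 < card (small_subsets U r)"
      using \<open>finite U\<close> by (subst card_gt_0_iff) (auto simp: finite_small_subsets)
    then have few: "N * card (small_subsets U r) < 2 ^ card U"
      using Suc.prems by simp
    then obtain C where C: "min_distance_code U r C" "finite C" "card C = N"
      using Suc.IH by auto
    then obtain Y where "Y \<notin> C" "min_distance_code U r (insert Y C)"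
      using min_distance_code_extend[OF assms(1,2) C(1)] few by auto
    then show ?case
      using C by (intro exI[of _ "insert Y C"]) simp
  qed
  then show thesis
    using that by blast
qed

text \<open>Writing the bit 1 as 10 and the bit 0 as 01 makes all weights equal and doubles all distances.\<close>

definition balanced :: "'a set \<Rightarrow> 'a set \<Rightarrow> ('a \<times> bool) set" where
  "balanced U X = (\<lambda>x. (x, x \<in> X)) ` U"

lemma card_balanced: "card (balanced U X) = card U"
  by (simp add: balanced_def card_image inj_on_def)

lemma inj_on_balanced: "inj_on (balanced U) (Pow U)"
  by (rule inj_onI) (auto simp: balanced_def image_iff set_eq_iff)

lemma card_sym_diff_balanced:
  assumes "X \<subseteq> U" "Y \<subseteq> U"
  shows "card (sym_diff (balanced U X) (balanced U Y)) = 2 * card (sym_diff X Y)"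
proof -
  have "sym_diff (balanced U X) (balanced U Y) = sym_diff X Y \<times> UNIV"
    using assms by (auto simp: balanced_def)
  then show ?thesis
    by (simp add: card_cartesian_product)
qed

lemma min_distance_code_balanced:
  assumes "min_distance_code U r C"
  shows "min_distance_code (U \<times> UNIV) (2 * r) (balanced U ` C)"
  unfolding min_distance_code_def
proof
  show "balanced U ` C \<subseteq> Pow (U \<times> UNIV)"
    by (auto simp: balanced_def)
  show "pairwise (\<lambda>X Y. 2 * r \<le> card (sym_diff X Y)) (balanced U ` C)"
  proof (intro pairwise_imageI)
    fix X Y assume "X \<in> C" "Y \<in> C" "X \<noteq> Y"
    then have "r \<le> card (sym_diff X Y)" "X \<subseteq> U" "Y \<subseteq> U"
      using assms by (auto simp: min_distance_code_def pairwise_def)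
    then show "2 * r \<le> card (sym_diff (balanced U X) (balanced U Y))"
      by (simp only: card_sym_diff_balanced)
  qed
qed

lemma constant_weight_code:
  assumes "0 < s"
  obtains C where "min_distance_code ({..<8 * s} \<times> (UNIV :: bool set)) (2 * s) C"
    "\<And>X. X \<in> C \<Longrightarrow> card X = 8 * s" "card C = 2 ^ s"
proof -
  let ?U = "{..<8 * s}"
  let ?v = "card (small_subsets ?U s)"
  have "?v * 128 ^ s = ?v * 2 ^ (card ?U - s)"
    by (simp add: power_mult flip: left_diff_distrib')
  also have "\<dots> \<le> 3 ^ card ?U"
    using card_small_subsets_mult_power_le[of ?U 2 s] by (simp add: numeral_3_eq_3)
  also have "\<dots> = 6561 ^ s"
    by (simp add: power_mult)
  finally have "(2 ^ s * ?v) * 128 ^ s \<le> 2 ^ s * 6561 ^ s"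
    by simp
  also have "\<dots> \<le> (32768::nat) ^ s"
    by (simp add: power_mono flip: power_mult_distrib)
  also have "\<dots> = 2 ^ card ?U * 128 ^ s"
    by (simp add: power_mult flip: power_mult_distrib)
  finally have "2 ^ s * ?v \<le> 2 ^ card ?U"
    by simp
  then obtain C where C: "min_distance_code ?U s C" "card C = 2 ^ s"
    using gilbert_varshamov[of ?U s "2 ^ s"] assms by auto
  show thesis
  proof (rule that[of "balanced ?U ` C"])
    show "min_distance_code (?U \<times> UNIV) (2 * s) (balanced ?U ` C)"
      by (rule min_distance_code_balanced[OF C(1)])
    show "card X = 8 * s" if "X \<in> balanced ?U ` C" for X
      using that by (auto simp: card_balanced)
    have "inj_on (balanced ?U) C"
      using C(1) inj_on_balanced inj_on_subset by (metis min_distance_code_def)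
    then show "card (balanced ?U ` C) = 2 ^ s"
      using C(2) by (simp add: card_image)
  qed
qed

lemma Pow_embeds_in_cube:
  assumes "finite X" "card X \<le> d"
  obtains \<phi> where "\<And>S. \<phi> S \<in> cube d"
    "\<And>S T. S \<subseteq> X \<Longrightarrow> T \<subseteq> X \<Longrightarrow> hamming (\<phi> S) (\<phi> T) = real (card (sym_diff S T))"
proof -
  obtain e where e: "e ` X \<subseteq> {..<d}" "inj_on e X"
    using card_le_inj[of X "{..<d}"] assms by auto
  define \<phi> where "\<phi> S = map (\<lambda>i. i \<in> e ` S) [0..<d]" for S
  show thesis
  proof (rule that[of \<phi>])
    show "\<phi> S \<in> cube d" for S
      by (simp add: \<phi>_def cube_def)
  next
    fix S T assume "S \<subseteq> X" "T \<subseteq> X"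
    have "{i. i < length (\<phi> S) \<and> \<phi> S ! i \<noteq> \<phi> T ! i} = {i. i < d \<and> (i \<in> e ` S) \<noteq> (i \<in> e ` T)}"
      by (simp add: \<phi>_def cong: conj_cong)
    also have "\<dots> = sym_diff (e ` S) (e ` T)"
      using e(1) \<open>S \<subseteq> X\<close> \<open>T \<subseteq> X\<close> by blast
    also have "\<dots> = e ` sym_diff S T"
      using \<open>S \<subseteq> X\<close> \<open>T \<subseteq> X\<close> inj_on_image_set_diff[OF e(2)]
      by (metis Diff_subset image_Un subset_trans)
    finally have "hamming (\<phi> S) (\<phi> T) = real (card (e ` sym_diff S T))"
      by (simp only: hamming_def)
    moreover have "inj_on e (sym_diff S T)"
      using \<open>S \<subseteq> X\<close> \<open>T \<subseteq> X\<close> by (intro inj_on_subset[OF e(2)]) auto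
    ultimately show "hamming (\<phi> S) (\<phi> T) = real (card (sym_diff S T))"
      by (simp only: card_image)
  qed
qed

section \<open>Queries with a unique answer\<close>

lemma kth_nn_dist_eqI:
  assumes "finite P" "S \<subseteq> P" "card S = k" "1 \<le> k"
    and near: "\<And>p. p \<in> S \<Longrightarrow> \<delta> q p = r" and far: "\<And>p. p \<in> P - S \<Longrightarrow> r \<le> \<delta> q p"
  shows "kth_nn_dist \<delta> k P q = r"
proof -
  let ?M = "image_mset (\<delta> q) (mset_set (P - S))"
  let ?xs = "replicate k r @ sorted_list_of_multiset ?M"
  have "finite S"
    using assms finite_subset by blast
  have "mset_set P = mset_set S + mset_set (P - S)"
    using assms \<open>finite S\<close> by (subst mset_set_Union[symmetric]) (auto simp: Un_absorb1)
  moreover have "image_mset (\<delta> q) (mset_set S) = image_mset (\<lambda>_. r) (mset_set S)"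
    using near \<open>finite S\<close> by (intro image_mset_cong) auto
  ultimately have "image_mset (\<delta> q) (mset_set P) = mset ?xs"
    using assms by (simp add: image_mset_const_eq)
  moreover have "sorted ?xs"
    using \<open>finite P\<close> far by (auto simp: sorted_append)
  ultimately have "sorted_list_of_multiset (image_mset (\<delta> q) (mset_set P)) = ?xs"
    by (metis sorted_list_of_multiset_mset sorted_sort_id)
  then show ?thesis
    using \<open>1 \<le> k\<close> by (simp add: kth_nn_dist_def nth_append)
qed

lemma nn_answer_iff_eq:
  assumes "finite P" "S \<subseteq> P" "card S = k" "1 \<le> k" "1 \<le> c" "0 \<le> r"
    and "\<And>p. p \<in> S \<Longrightarrow> \<delta> q p = r" and far: "\<And>p. p \<in> P - S \<Longrightarrow> c * r < \<delta> q p"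
  shows "nn_answer \<delta> c k P q A \<longleftrightarrow> A = S"
proof -
  have "r \<le> c * r"
    using assms by (simp add: mult_le_cancel_right1)
  then have kth: "kth_nn_dist \<delta> k P q = r"
    using assms by (intro kth_nn_dist_eqI[of P S]) force+
  show ?thesis
  proof
    assume "nn_answer \<delta> c k P q A"
    then have "A \<subseteq> S" "card A = k"
      using kth far unfolding nn_answer_def by force+
    then show "A = S"
      using assms by (metis card_subset_eq finite_subset)
  next
    assume "A = S"
    then show "nn_answer \<delta> c k P q A"
      using assms kth \<open>r \<le> c * r\<close> by (simp add: nn_answer_def)
  qed
qed

definition isolates_transversals ::
  "('p \<Rightarrow> 'p \<Rightarrow> real) \<Rightarrow> 'p set \<Rightarrow> real \<Rightarrow> 'p set \<Rightarrow> 'i set \<Rightarrow> ('i \<Rightarrow> 'p set) \<Rightarrow> bool" where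
  "isolates_transversals \<delta> Q c P I G \<longleftrightarrow>
     disjoint_family_on G I \<and>
     (\<forall>f\<in>Pi\<^sub>E I G. \<exists>q\<in>Q. \<forall>A. nn_answer \<delta> c (card I) P q A \<longleftrightarrow> A = f ` I)"

lemma card_sym_diff_Sigma_single:
  assumes "finite I" "i \<in> I" "\<And>l. l \<in> I \<Longrightarrow> finite (g l)" "finite X"
  shows "card (sym_diff (Sigma I g) ({i} \<times> X)) =
    (\<Sum>l\<in>I - {i}. card (g l)) + card (sym_diff (g i) X)"
proof -
  let ?h = "g(i := sym_diff (g i) X)"
  have "sym_diff (Sigma I g) ({i} \<times> X) = Sigma I ?h"
    using \<open>i \<in> I\<close> by (auto split: if_splits)
  then have "card (sym_diff (Sigma I g) ({i} \<times> X)) = (\<Sum>l\<in>I. card (?h l))"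
    using assms by simp
  also have "\<dots> = card (sym_diff (g i) X) + (\<Sum>l\<in>I - {i}. card (?h l))"
    using assms by (simp add: sum.remove)
  also have "(\<Sum>l\<in>I - {i}. card (?h l)) = (\<Sum>l\<in>I - {i}. card (g l))"
    by (intro sum.cong) auto
  finally show ?thesis
    by simp
qed

text \<open>The pair \<open>(i, v)\<close> stands for position \<open>v\<close> of segment \<open>i\<close>.\<close>

locale segmented_code =
  fixes \<delta> :: "'p \<Rightarrow> 'p \<Rightarrow> real" and I :: "'i set" and V :: "'v set" and C :: "'v set set"
    and w r :: nat and \<phi> :: "('i \<times> 'v) set \<Rightarrow> 'p"
  assumes finite_I: "finite I" and I_nonempty: "I \<noteq> {}" and finite_V: "finite V"
    and code: "min_distance_code V r C"
    and weight: "X \<in> C \<Longrightarrow> card X = w" and weight_pos: "0 < w"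
    and isometry: "S \<subseteq> I \<times> V \<Longrightarrow> T \<subseteq> I \<times> V \<Longrightarrow> \<delta> (\<phi> S) (\<phi> T) = real (card (sym_diff S T))"
begin

definition point :: "'i \<Rightarrow> 'v set \<Rightarrow> 'p" where
  "point i X = \<phi> ({i} \<times> X)"

definition points :: "'v set set \<Rightarrow> 'p set" where
  "points C' = (\<lambda>(i, X). point i X) ` (I \<times> C')"

definition query :: "('i \<Rightarrow> 'v set) \<Rightarrow> 'p" where
  "query g = \<phi> (Sigma I g)"

lemma codeword_subset: "X \<in> C \<Longrightarrow> X \<subseteq> V"
  using code by (auto simp: min_distance_code_def)

lemma finite_codeword: "X \<in> C \<Longrightarrow> finite X"
  using codeword_subset finite_V finite_subset by blast

lemma finite_code: "finite C"
  using codeword_subset finite_V by (meson PowI finite_Pow_iff finite_subset subsetI)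

lemma dist_query_point:
  assumes "g \<in> I \<rightarrow> C" "i \<in> I" "X \<in> C"
  shows "\<delta> (query g) (point i X) = real ((card I - 1) * w + card (sym_diff (g i) X))"
proof -
  have "Sigma I g \<subseteq> I \<times> V" "{i} \<times> X \<subseteq> I \<times> V"
    using assms codeword_subset by blast+
  then have "\<delta> (query g) (point i X) = real (card (sym_diff (Sigma I g) ({i} \<times> X)))"
    by (simp only: query_def point_def isometry)
  also have "card (sym_diff (Sigma I g) ({i} \<times> X)) =
      (\<Sum>l\<in>I - {i}. card (g l)) + card (sym_diff (g i) X)"
    using assms finite_I finite_codeword by (intro card_sym_diff_Sigma_single) auto
  also have "(\<Sum>l\<in>I - {i}. card (g l)) = (\<Sum>l\<in>I - {i}. w)"
    using assms(1) weight by (intro sum.cong) auto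
  also have "\<dots> = (card I - 1) * w"
    using \<open>i \<in> I\<close> by simp
  finally show ?thesis .
qed

lemma point_eq_iff:
  assumes mem: "i \<in> I" "X \<in> C" "j \<in> I" "Y \<in> C"
  shows "point i X = point j Y \<longleftrightarrow> i = j \<and> X = Y"
proof
  assume eq: "point i X = point j Y"
  have box: "{i} \<times> X \<subseteq> I \<times> V" "{j} \<times> Y \<subseteq> I \<times> V"
    using mem codeword_subset by blast+
  have "card (sym_diff ({i} \<times> X) ({j} \<times> Y)) = card (sym_diff ({i} \<times> X) ({i} \<times> X))"
    using isometry[OF box] isometry[OF box(1) box(1)] eq by (simp add: point_def)
  then have "sym_diff ({i} \<times> X) ({j} \<times> Y) = {}"
    using mem finite_codeword by simp
  then have "{i} \<times> X = {j} \<times> Y"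
    by blast
  moreover have "X \<noteq> {}"
    using weight[OF \<open>X \<in> C\<close>] weight_pos by auto
  ultimately show "i = j \<and> X = Y"
    by blast
qed simp

lemma card_points:
  assumes "C' \<subseteq> C"
  shows "card (points C') = card I * card C'"
proof -
  have "inj_on (\<lambda>(i, X). point i X) (I \<times> C')"
    using subsetD[OF assms] by (auto simp: inj_on_def point_eq_iff)
  then show ?thesis
    by (simp add: points_def card_image card_cartesian_product)
qed

lemma card_image_point:
  assumes "i \<in> I" "C' \<subseteq> C"
  shows "card (point i ` C') = card C'"
  using assms(1) subsetD[OF assms(2)] by (intro card_image) (simp add: inj_on_def point_eq_iff)

lemma finite_points: "finite (points C)"
  using finite_I finite_code by (simp add: points_def)

lemma nn_answer_query_iff:
  assumes "1 \<le> c" and gap: "c * real ((card I - 1) * w) < real ((card I - 1) * w + r)"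
    and P: "P \<subseteq> points C"
    and g: "g \<in> I \<rightarrow> C" and sub: "(\<lambda>i. point i (g i)) ` I \<subseteq> P"
  shows "nn_answer \<delta> c (card I) P (query g) A \<longleftrightarrow> A = (\<lambda>i. point i (g i)) ` I"
proof (rule nn_answer_iff_eq[where r = "real ((card I - 1) * w)"])
  show "finite P"
    using P finite_points by (rule finite_subset)
  have "inj_on (\<lambda>i. point i (g i)) I"
    using funcset_mem[OF g] by (simp add: inj_on_def point_eq_iff)
  then show "card ((\<lambda>i. point i (g i)) ` I) = card I"
    by (rule card_image)
  show "1 \<le> card I"
    using finite_I I_nonempty by (simp add: Suc_le_eq card_gt_0_iff)
next
  fix p assume "p \<in> (\<lambda>i. point i (g i)) ` I"
  then show "\<delta> (query g) p = real ((card I - 1) * w)"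
    using dist_query_point[OF g] funcset_mem[OF g] by auto
next
  fix p assume "p \<in> P - (\<lambda>i. point i (g i)) ` I"
  moreover from this obtain i X where p: "p = point i X" "i \<in> I" "X \<in> C"
    using P by (auto simp: points_def)
  ultimately have "g i \<noteq> X"
    by auto
  then have "r \<le> card (sym_diff (g i) X)"
    using code g p by (auto simp: min_distance_code_def pairwise_def)
  then have "real ((card I - 1) * w + r) \<le> \<delta> (query g) p"
    using p dist_query_point[OF g] by simp
  then show "c * real ((card I - 1) * w) < \<delta> (query g) p"
    using gap by linarith
qed (use \<open>1 \<le> c\<close> sub in auto)

lemma isolates_transversals_point:
  assumes "1 \<le> c" and gap: "c * real ((card I - 1) * w) < real ((card I - 1) * w + r)"
    and "C' \<subseteq> C" and P: "points C' \<subseteq> P" "P \<subseteq> points C"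
    and Q: "\<phi> ` Pow (I \<times> V) \<subseteq> Q"
  shows "isolates_transversals \<delta> Q c P I (\<lambda>i. point i ` C')"
  unfolding isolates_transversals_def
proof (intro conjI ballI)
  show "disjoint_family_on (\<lambda>i. point i ` C') I"
    using subsetD[OF \<open>C' \<subseteq> C\<close>] by (auto simp: disjoint_family_on_def point_eq_iff)
next
  fix f assume "f \<in> (\<Pi>\<^sub>E i\<in>I. point i ` C')"
  then have "\<forall>i\<in>I. \<exists>X. X \<in> C' \<and> f i = point i X"
    by auto
  then obtain g where g: "\<And>i. i \<in> I \<Longrightarrow> g i \<in> C' \<and> f i = point i (g i)"
    by metis
  then have g_C: "g \<in> I \<rightarrow> C" and image: "f ` I = (\<lambda>i. point i (g i)) ` I"
    using \<open>C' \<subseteq> C\<close> by auto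
  have "f ` I \<subseteq> P"
    using g P(1) by (fastforce simp: points_def)
  then have "nn_answer \<delta> c (card I) P (query g) A \<longleftrightarrow> A = f ` I" for A
    using nn_answer_query_iff[OF \<open>1 \<le> c\<close> gap P(2) g_C] image by simp
  moreover have "query g \<in> Q"
    using Q g_C codeword_subset by (fastforce simp: query_def)
  ultimately show "\<exists>q\<in>Q. \<forall>A. nn_answer \<delta> c (card I) P q A \<longleftrightarrow> A = f ` I"
    by blast
qed

end

lemma constant_weight_gap:
  fixes c :: real
  assumes "1 \<le> k" "c < 1 + 1 / (4 * real k)" "w \<le> 4 * r" "0 < r"
  shows "c * real ((k - 1) * w) < real ((k - 1) * w + r)"
proof -
  have "(c - 1) * real ((k - 1) * w) \<le> 1 / (4 * real k) * real ((k - 1) * w)"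
    using assms by (intro mult_right_mono) auto
  also have "\<dots> \<le> 1 / (4 * real k) * real ((k - 1) * (4 * r))"
    using \<open>w \<le> 4 * r\<close> by (intro mult_left_mono of_nat_mono) auto
  also have "\<dots> < real r"
    using assms by (simp add: field_simps of_nat_diff)
  finally show ?thesis
    by (simp add: algebra_simps)
qed

lemma point_set_with_isolated_transversals:
  fixes c :: real
  assumes "1 \<le> k" "1 \<le> c" "c < 1 + 1 / (4 * real k)"
    and "0 < s" "n div k < 2 ^ s" "k * (16 * s) \<le> d"
  obtains P G where "P \<in> point_sets n d"
    "isolates_transversals hamming (cube d) c P {..<k} G"
    "\<And>i. i < k \<Longrightarrow> card (G i) = n div k"
proof -
  let ?V = "{..<8 * s} \<times> (UNIV :: bool set)"
  obtain C where C: "min_distance_code ?V (2 * s) C" "\<And>X. X \<in> C \<Longrightarrow> card X = 8 * s"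
    and card_C: "card C = 2 ^ s"
    using constant_weight_code[OF \<open>0 < s\<close>] by blast
  have "card ({..<k} \<times> ?V) \<le> d"
    using assms by (simp add: card_cartesian_product)
  then obtain \<phi> :: "(nat \<times> nat \<times> bool) set \<Rightarrow> bool list" where \<phi>_cube: "\<And>S. \<phi> S \<in> cube d"
    and \<phi>: "\<And>S T. S \<subseteq> {..<k} \<times> ?V \<Longrightarrow> T \<subseteq> {..<k} \<times> ?V \<Longrightarrow>
      hamming (\<phi> S) (\<phi> T) = real (card (sym_diff S T))"
    using Pow_embeds_in_cube[of "{..<k} \<times> ?V" d] by auto
  interpret segmented_code hamming "{..<k}" ?V C "8 * s" "2 * s" \<phi>
    by unfold_locales (use \<open>1 \<le> k\<close> \<open>0 < s\<close> in \<open>simp_all add: C \<phi> lessThan_empty_iff\<close>)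
  \<comment> \<open>The groups use only \<open>n div k\<close> codewords; the others supply the remaining points of \<open>P\<close> when
    \<open>k\<close> does not divide \<open>n\<close>.\<close>
  obtain C' where C': "C' \<subseteq> C" "card C' = n div k"
    using obtain_subset_with_card_n[of "n div k" C] assms(5) card_C by auto
  have "n < k * card C"
    using assms card_C by (simp add: div_less_iff_less_mult mult.commute)
  then obtain P where P: "points C' \<subseteq> P" "P \<subseteq> points C" "card P = n"
    using exists_subset_between[of "points C'" n "points C"] card_points C' finite_points
    by (auto simp: points_def)
  show thesis
  proof (rule that[of P "\<lambda>i. point i ` C'"])
    show "P \<in> point_sets n d"
      using P \<phi>_cube by (auto simp: point_sets_def points_def point_def)
    show "card (point i ` C') = n div k" if "i < k" for i
      using card_image_point[OF _ C'(1)] C'(2) that by simp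
    have "c * real ((k - 1) * (8 * s)) < real ((k - 1) * (8 * s) + 2 * s)"
      using assms by (intro constant_weight_gap) auto
    then show "isolates_transversals hamming (cube d) c P {..<k} (\<lambda>i. point i ` C')"
      using \<open>1 \<le> c\<close> C'(1) P \<phi>_cube by (intro isolates_transversals_point) auto
  qed
qed

section \<open>Counting covered transversals\<close>

lemma prod_le_mean_power:
  fixes x :: "'i \<Rightarrow> real"
  assumes "finite I" "I \<noteq> {}" "\<And>i. i \<in> I \<Longrightarrow> 0 \<le> x i"
  shows "(\<Prod>i\<in>I. x i) \<le> ((\<Sum>i\<in>I. x i) / real (card I)) ^ card I"
proof (cases "(\<Prod>i\<in>I. x i) = 0")
  case True
  then show ?thesis
    using assms(3) by (simp only: True) (intro zero_le_power divide_nonneg_nonneg sum_nonneg; simp)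
next
  case False
  have "(\<Prod>i\<in>I. x i) powr (1 / real (card I)) \<le> (\<Sum>i\<in>I. x i) / real (card I)"
    using arith_geom_mean[OF assms] by (simp add: sum_divide_distrib)
  then have "((\<Prod>i\<in>I. x i) powr (1 / real (card I))) ^ card I
      \<le> ((\<Sum>i\<in>I. x i) / real (card I)) ^ card I"
    by (intro power_mono) auto
  moreover have "((\<Prod>i\<in>I. x i) powr (1 / real (card I))) ^ card I = (\<Prod>i\<in>I. x i)"
    using False assms by (simp add: powr_power prod_nonneg)
  ultimately show ?thesis
    by simp
qed

definition transversals_in :: "'i set \<Rightarrow> ('i \<Rightarrow> 'p set) \<Rightarrow> 'p set \<Rightarrow> ('i \<Rightarrow> 'p) set" where
  "transversals_in I G U = {f \<in> Pi\<^sub>E I G. f ` I \<subseteq> U}"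

lemma card_transversals_in_le:
  assumes "finite I" "I \<noteq> {}" "finite U" and disjoint: "disjoint_family_on G I"
  shows "real (card (transversals_in I G U)) \<le> (real (card U) / real (card I)) ^ card I"
proof -
  have "transversals_in I G U = (\<Pi>\<^sub>E i\<in>I. G i \<inter> U)"
    by (auto simp: transversals_in_def PiE_iff extensional_def)
  then have "real (card (transversals_in I G U)) = (\<Prod>i\<in>I. real (card (G i \<inter> U)))"
    using \<open>finite I\<close> by (simp add: card_PiE)
  also have "\<dots> \<le> ((\<Sum>i\<in>I. real (card (G i \<inter> U))) / real (card I)) ^ card I"
    using assms by (intro prod_le_mean_power) auto
  also have "\<dots> \<le> (real (card U) / real (card I)) ^ card I"
  proof (intro power_mono divide_right_mono)
    have "disjoint_family_on (\<lambda>i. G i \<inter> U) I"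
      using disjoint by (auto simp: disjoint_family_on_def)
    then have "(\<Sum>i\<in>I. card (G i \<inter> U)) = card (\<Union>i\<in>I. G i \<inter> U)"
      using assms by (intro card_UN_disjoint'[symmetric]) auto
    also have "\<dots> \<le> card U"
      using \<open>finite U\<close> by (intro card_mono) auto
    finally show "(\<Sum>i\<in>I. real (card (G i \<inter> U))) \<le> real (card U)"
      by (simp flip: of_nat_sum)
  qed (auto simp: sum_nonneg)
  finally show ?thesis .
qed

lemma card_nonempty_subsets_le:
  assumes "finite A"
  shows "card {S. S \<subseteq> A \<and> S \<noteq> {} \<and> card S \<le> t} \<le> card A ^ t"
proof -
  let ?L = "{xs. set xs \<subseteq> A \<and> length xs = t}"
  have "{S. S \<subseteq> A \<and> S \<noteq> {} \<and> card S \<le> t} \<subseteq> set ` ?L"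
  proof clarify
    fix S assume S: "S \<subseteq> A" "S \<noteq> {}" "card S \<le> t"
    then obtain xs x where "set xs = S" "length xs = card S" "x \<in> S"
      using assms by (metis all_not_in_conv distinct_card finite_distinct_list finite_subset)
    then show "S \<in> set ` ?L"
      using S by (intro image_eqI[of _ _ "xs @ replicate (t - card S) x"]) auto
  qed
  then have "card {S. S \<subseteq> A \<and> S \<noteq> {} \<and> card S \<le> t} \<le> card ?L"
    using assms by (simp add: surj_card_le finite_lists_length_eq)
  then show ?thesis
    using assms by (simp add: card_lists_length_eq)
qed

lemma card_Union_le_mult:
  assumes "card S \<le> t" "\<And>b. b \<in> S \<Longrightarrow> card b \<le> B"
  shows "card (\<Union>S) \<le> t * B"
proof -
  have "card (\<Union>S) \<le> (\<Sum>b\<in>S. card b)"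
    by (rule card_Union_le_sum_card)
  also have "\<dots> \<le> card S * B"
    using sum_bounded_above[of S card B] assms(2) by simp
  also have "\<dots> \<le> t * B"
    using assms(1) by simp
  finally show ?thesis .
qed

lemma card_transversals_in_Union_le:
  assumes "finite I" "I \<noteq> {}" "disjoint_family_on G I"
    and "finite S" "card S \<le> t" and blocks: "\<And>b. b \<in> S \<Longrightarrow> finite b \<and> card b \<le> B"
  shows "real (card (transversals_in I G (\<Union>S))) \<le> (real (t * B) / real (card I)) ^ card I"
proof -
  have "finite (\<Union>S)"
    using \<open>finite S\<close> blocks by auto
  then have "real (card (transversals_in I G (\<Union>S))) \<le> (real (card (\<Union>S)) / real (card I)) ^ card I"
    using assms by (intro card_transversals_in_le)
  also have "\<dots> \<le> (real (t * B) / real (card I)) ^ card I"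
    using \<open>card S \<le> t\<close> blocks
    by (intro power_mono divide_right_mono of_nat_mono card_Union_le_mult) auto
  finally show ?thesis .
qed

lemma card_covered_transversals_le:
  assumes "finite I" "I \<noteq> {}" "disjoint_family_on G I"
    and "finite \<B>" and blocks: "\<And>b. b \<in> \<B> \<Longrightarrow> finite b \<and> card b \<le> B"
    and cover: "\<And>f. f \<in> Pi\<^sub>E I G \<Longrightarrow> \<exists>S\<subseteq>\<B>. card S \<le> t \<and> f ` I \<subseteq> \<Union>S"
  shows "(\<Prod>i\<in>I. real (card (G i)))
    \<le> real (card \<B>) ^ t * (real (t * B) / real (card I)) ^ card I"
proof -
  let ?\<S> = "{S. S \<subseteq> \<B> \<and> S \<noteq> {} \<and> card S \<le> t}"
  let ?bound = "(real (t * B) / real (card I)) ^ card I"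
  have "finite ?\<S>"
    using \<open>finite \<B>\<close> by simp
  have "Pi\<^sub>E I G = (\<Union>S\<in>?\<S>. transversals_in I G (\<Union>S))"
  proof (intro equalityI subsetI)
    fix f assume f: "f \<in> Pi\<^sub>E I G"
    then obtain S where S: "S \<subseteq> \<B>" "card S \<le> t" "f ` I \<subseteq> \<Union>S"
      using cover[OF f] by (elim exE conjE)
    moreover have "S \<noteq> {}"
      using S(3) \<open>I \<noteq> {}\<close> by auto
    ultimately show "f \<in> (\<Union>S\<in>?\<S>. transversals_in I G (\<Union>S))"
      using f by (intro UN_I[of S]) (simp_all add: transversals_in_def)
  qed (auto simp: transversals_in_def)
  then have "(\<Prod>i\<in>I. real (card (G i))) = real (card (\<Union>S\<in>?\<S>. transversals_in I G (\<Union>S)))"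
    using \<open>finite I\<close> by (simp flip: card_PiE of_nat_prod)
  also have "\<dots> \<le> (\<Sum>S\<in>?\<S>. real (card (transversals_in I G (\<Union>S))))"
    using card_UN_le[OF \<open>finite ?\<S>\<close>, of "\<lambda>S. transversals_in I G (\<Union>S)"]
    by (simp flip: of_nat_sum)
  also have "\<dots> \<le> real (card ?\<S>) * ?bound"
  proof (rule sum_bounded_above)
    fix S assume "S \<in> ?\<S>"
    then have "S \<subseteq> \<B>" "card S \<le> t"
      by auto
    then show "real (card (transversals_in I G (\<Union>S))) \<le> ?bound"
      using assms(1-3) blocks finite_subset[OF _ \<open>finite \<B>\<close>]
      by (intro card_transversals_in_Union_le) auto
  qed
  also have "\<dots> \<le> real (card \<B>) ^ t * ?bound"
    using card_nonempty_subsets_le[OF \<open>finite \<B>\<close>, of t]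
    by (intro mult_right_mono) (simp_all flip: of_nat_power)
  finally show ?thesis .
qed

section \<open>The space bound\<close>

lemma query_time_leE:
  assumes "query_time \<delta> c k P \<B> q \<le> enat t"
  obtains S A where "S \<subseteq> \<B>" "card S \<le> t" "nn_answer \<delta> c k P q A" "A \<subseteq> \<Union>S"
proof -
  let ?X = "{enat (card S) | S. S \<subseteq> \<B> \<and> finite S \<and> (\<exists>A. nn_answer \<delta> c k P q A \<and> A \<subseteq> \<Union> S)}"
  have "Inf ?X < enat (Suc t)"
    using assms unfolding query_time_def by (rule le_less_trans) simp
  then obtain x where "x \<in> ?X" "x < enat (Suc t)"
    unfolding Inf_less_iff by blast
  then show thesis
    using that by auto
qed

lemma isolates_transversals_imp_space_bound:
  assumes "finite I" "I \<noteq> {}" "finite P" and blocks: "block_collection B P \<B>"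
    and time: "worst_query_time \<delta> Q c (card I) P \<B> \<le> enat t"
    and isolated: "isolates_transversals \<delta> Q c P I G"
  shows "(\<Prod>i\<in>I. real (card (G i)))
    \<le> real (card \<B>) ^ t * (real (t * B) / real (card I)) ^ card I"
proof (rule card_covered_transversals_le[OF \<open>finite I\<close> \<open>I \<noteq> {}\<close>])
  show "disjoint_family_on G I"
    using isolated by (simp add: isolates_transversals_def)
  show "finite \<B>"
    using blocks \<open>finite P\<close> by (meson PowI block_collection_def finite_Pow_iff finite_subset subsetI)
  show "finite b \<and> card b \<le> B" if "b \<in> \<B>" for b
    using blocks \<open>finite P\<close> that by (auto simp: block_collection_def intro: finite_subset)
next
  fix f assume "f \<in> Pi\<^sub>E I G"
  then obtain q where "q \<in> Q" and q: "\<And>A. nn_answer \<delta> c (card I) P q A \<longleftrightarrow> A = f ` I"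
    using isolated unfolding isolates_transversals_def by blast
  have "query_time \<delta> c (card I) P \<B> q \<le> enat t"
    using time \<open>q \<in> Q\<close> by (simp add: worst_query_time_def SUP_le_iff)
  then obtain S A where "S \<subseteq> \<B>" "card S \<le> t" "nn_answer \<delta> c (card I) P q A" "A \<subseteq> \<Union>S"
    by (rule query_time_leE)
  then show "\<exists>S\<subseteq>\<B>. card S \<le> t \<and> f ` I \<subseteq> \<Union>S"
    by (intro exI[of _ S]) (simp add: q)
qed

lemma nat_ceiling_le_double:
  fixes x :: real
  assumes "1 / 2 \<le> x"
  shows "real (nat \<lceil>x\<rceil>) \<le> 2 * x"
proof (cases "x \<le> 1")
  case True
  then have "\<lceil>x\<rceil> \<le> 1"
    by (simp add: ceiling_le_iff)
  then show ?thesis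
    using assms by linarith
next
  case False
  then show ?thesis
    by linarith
qed

lemma nat_ceiling_divide_mult_le:
  fixes x a :: real
  assumes "0 < a" "a \<le> 2 * x"
  shows "real (nat \<lceil>x / a\<rceil>) * a \<le> 2 * x"
proof -
  have "real (nat \<lceil>x / a\<rceil>) \<le> 2 * (x / a)"
    using assms by (intro nat_ceiling_le_double) (simp add: field_simps)
  then show ?thesis
    using \<open>0 < a\<close> by (simp add: field_simps)
qed

lemma le_double_div_mult:
  fixes n k :: nat
  assumes "1 \<le> k" "k \<le> n"
  shows "n \<le> 2 * (n div k) * k"
proof -
  have "n < Suc (n div k) * k"
    using \<open>1 \<le> k\<close> by (simp add: dividend_less_div_times)
  also have "1 \<le> n div k"
    using assms by (simp add: Suc_le_eq div_greater_zero_iff)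
  then have "Suc (n div k) * k \<le> 2 * (n div k) * k"
    by (intro mult_right_mono) auto
  finally show ?thesis
    by simp
qed

lemma powr_le_of_power_le_power:
  fixes x y b :: real
  assumes "0 < y" "1 \<le> x" "0 < t" "0 \<le> b" "real t * b \<le> real k" "y ^ k \<le> x ^ t"
  shows "y powr b \<le> x"
proof (cases "y \<le> 1")
  case True
  then have "y powr b \<le> 1"
    using assms by (intro powr_le1) auto
  then show ?thesis
    using \<open>1 \<le> x\<close> by linarith
next
  case False
  have "(y powr b) ^ t = y powr (real t * b)"
    using \<open>0 < y\<close> by (simp add: powr_power)
  also have "\<dots> \<le> y powr real k"
    using False assms by (intro powr_mono) auto
  also have "\<dots> \<le> x ^ t"
    using assms by (simp add: powr_realpow)
  finally show ?thesis
    using assms by simp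
qed

lemma transversal_count_imp_power_le:
  fixes \<alpha> M :: real
  assumes "0 < k" "0 < B" "0 < t" "0 < \<alpha>" "real t * \<alpha> \<le> 2 * real k" "n \<le> 2 * m * k"
    and count: "real m ^ k \<le> M ^ t * (real (t * B) / real k) ^ k"
  shows "(real n * \<alpha> / (real k * real B) / 4) ^ k \<le> M ^ t"
proof -
  let ?y = "real n * \<alpha> / (real k * real B) / 4"
  have "real n \<le> 2 * real m * real k"
    using \<open>n \<le> 2 * m * k\<close> by (metis of_nat_le_iff of_nat_mult of_nat_numeral)
  then have "real n * (real t * \<alpha>) \<le> (2 * real m * real k) * (2 * real k)"
    using \<open>real t * \<alpha> \<le> 2 * real k\<close> by (rule mult_mono) (use assms in simp_all)
  then have "?y * (real (t * B) / real k) \<le> real m"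
    using assms by (simp add: field_simps)
  then have "(?y * (real (t * B) / real k)) ^ k \<le> real m ^ k"
    using assms by (intro power_mono) auto
  then have "?y ^ k * (real (t * B) / real k) ^ k \<le> M ^ t * (real (t * B) / real k) ^ k"
    using count unfolding power_mult_distrib by (rule order_trans)
  moreover have "0 < (real (t * B) / real k) ^ k"
    using assms by simp
  ultimately show ?thesis
    by (simp only: mult_le_cancel_right_pos)
qed

lemma transversal_count_imp_powr_le:
  fixes \<alpha> M :: real
  assumes "0 < k" "0 < n" "0 < B" "0 < t" "0 < \<alpha>" "real t * \<alpha> \<le> 2 * real k" "n \<le> 2 * m * k"
    and "1 \<le> M" and "real m ^ k \<le> M ^ t * (real (t * B) / real k) ^ k"
  shows "(1 / (2 * exp 1) * sqrt (real n * \<alpha> / (real k * real B))) powr \<alpha> \<le> M"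
proof -
  define y where "y = real n * \<alpha> / (real k * real B) / 4"
  have "0 < y"
    using assms by (simp add: y_def)
  have "y ^ k \<le> M ^ t"
    unfolding y_def using assms by (intro transversal_count_imp_power_le)
  have "sqrt y = sqrt (real n * \<alpha> / (real k * real B)) / 2"
    by (simp only: y_def real_sqrt_divide real_sqrt_four)
  then have "1 / (2 * exp 1) * sqrt (real n * \<alpha> / (real k * real B)) = sqrt y / exp 1"
    by (simp only: divide_divide_eq_left times_divide_eq_left mult_1)
  also have "\<dots> \<le> sqrt y / 1"
    using \<open>0 < y\<close> by (intro divide_left_mono) auto
  finally have "(1 / (2 * exp 1) * sqrt (real n * \<alpha> / (real k * real B))) powr \<alpha> \<le> sqrt y powr \<alpha>"
    using assms by (intro powr_mono2) auto
  also have "\<dots> = y powr (\<alpha> / 2)"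
    using \<open>0 < y\<close> by (simp add: powr_powr flip: powr_half_sqrt)
  also have "\<dots> \<le> M"
    using \<open>0 < y\<close> \<open>y ^ k \<le> M ^ t\<close> assms by (intro powr_le_of_power_le_power[of y M t _ k]) auto
  finally show ?thesis .
qed

lemma indexing_scheme_space_bound:
  fixes c \<alpha> :: real
  assumes "1 \<le> k" "k \<le> n" "1 \<le> c" "c < 1 + 1 / (4 * real k)"
    and "1 \<le> \<alpha>" "\<alpha> \<le> real B" "\<alpha> \<le> 2 * real k"
    and "0 < s" "n div k < 2 ^ s" "k * (16 * s) \<le> d"
    and scheme: "hamming_indexing_scheme n d c k B (nat \<lceil>real k / \<alpha>\<rceil>) I"
  obtains P where "P \<in> point_sets n d"
    "(1 / (2 * exp 1) * sqrt (real n * \<alpha> / (real k * real B))) powr \<alpha> \<le> real (card (I P))"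
proof -
  define t where "t = nat \<lceil>real k / \<alpha>\<rceil>"
  obtain P G where P: "P \<in> point_sets n d"
    and isolated: "isolates_transversals hamming (cube d) c P {..<k} G"
    and card_G: "\<And>i. i < k \<Longrightarrow> card (G i) = n div k"
    using point_set_with_isolated_transversals[of k c s n d] assms by blast
  have "finite P"
    using P assms by (auto simp: point_sets_def intro: card_ge_0_finite)
  have "block_collection B P (I P)" "worst_query_time hamming (cube d) c k P (I P) \<le> enat t"
    using scheme P by (auto simp: hamming_indexing_scheme_def t_def)
  then have "(\<Prod>i<k. real (card (G i))) \<le> real (card (I P)) ^ t * (real (t * B) / real k) ^ k"
    using isolates_transversals_imp_space_bound[of "{..<k}" P B "I P"] isolated \<open>finite P\<close> \<open>1 \<le> k\<close>
    by (simp add: lessThan_empty_iff)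
  then have count: "real (n div k) ^ k \<le> real (card (I P)) ^ t * (real (t * B) / real k) ^ k"
    using card_G by simp
  have "0 < t"
    using assms by (simp add: t_def)
  have t_le: "real t * \<alpha> \<le> 2 * real k"
    unfolding t_def using assms by (intro nat_ceiling_divide_mult_le) auto
  have "0 < n div k"
    using assms by (simp add: div_greater_zero_iff)
  then have "0 < real (n div k) ^ k"
    by simp
  then have "0 < real (card (I P)) ^ t * (real (t * B) / real k) ^ k"
    using count by (rule less_le_trans)
  then have "1 \<le> real (card (I P))"
    using \<open>0 < t\<close> by (cases "card (I P) = 0") (auto simp: zero_power)
  then have "(1 / (2 * exp 1) * sqrt (real n * \<alpha> / (real k * real B))) powr \<alpha> \<le> real (card (I P))"
    using transversal_count_imp_powr_le[OF _ _ _ \<open>0 < t\<close> _ t_le le_double_div_mult _ count] assms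
    by simp
  then show thesis
    by (rule that[OF P])
qed

lemma obtain_two_power_greater:
  fixes x :: real
  assumes "1 \<le> x"
  obtains s :: nat where "0 < s" "x < 2 ^ s" "real s \<le> 2 * max 1 (log 2 x)"
proof
  let ?s = "nat \<lfloor>log 2 x\<rfloor> + 1"
  show "0 < ?s"
    by simp
  have "0 \<le> log 2 x"
    using assms by simp
  then show "real ?s \<le> 2 * max 1 (log 2 x)"
    by linarith
  have "log 2 x < real ?s"
    by linarith
  then have "x < 2 powr real ?s"
    using assms by (simp add: log_less_iff)
  then show "x < 2 ^ ?s"
    by (simp only: powr_realpow zero_less_numeral)
qed

theorem theorem3:
  "\<exists>C>0. \<exists>\<gamma>>0. \<forall>(n::nat) (k::nat) (c::real) (B::nat) (\<alpha>::real).
     1 \<le> k \<and> k \<le> n \<and> 1 < c \<and> c < 1 + 1 / (4 * real k) \<and>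
     1 \<le> \<alpha> \<and> \<alpha> \<le> real B \<and> \<alpha> \<le> 2 * real k \<longrightarrow>
     (\<exists>d0::nat. real d0 \<le> C * (real k * max 1 (log 2 (real n / real k))) \<and>
        (\<forall>d\<ge>d0. \<forall>I.
           hamming_indexing_scheme n d c k B (nat \<lceil>real k / \<alpha>\<rceil>) I \<longrightarrow>
           (\<exists>P\<in>point_sets n d.
              real (card (I P)) \<ge>
                \<gamma> * (1 / (2 * exp 1) * sqrt (real n * \<alpha> / (real k * real B))) powr \<alpha>)))"
proof (rule exI[of _ 32], intro conjI exI[of _ "1::real"] allI impI; (elim conjE)?)
  fix n k B :: nat and c \<alpha> :: real
  assume params: "1 \<le> k" "k \<le> n" "1 < c" "c < 1 + 1 / (4 * real k)"
    "1 \<le> \<alpha>" "\<alpha> \<le> real B" "\<alpha> \<le> 2 * real k"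
  then obtain s :: nat where "0 < s" and "real n / real k < 2 ^ s"
    and s_le: "real s \<le> 2 * max 1 (log 2 (real n / real k))"
    using obtain_two_power_greater[of "real n / real k"] by auto
  have "real (n div k) < 2 ^ s"
    using of_nat_div_le_of_nat \<open>real n / real k < 2 ^ s\<close> by (rule le_less_trans)
  then have "n div k < 2 ^ s"
    by simp
  have "real (k * (16 * s)) \<le> 32 * (real k * max 1 (log 2 (real n / real k)))"
    using mult_left_mono[OF s_le, of "16 * real k"] by (simp add: mult_ac)
  then show "\<exists>d0::nat. real d0 \<le> 32 * (real k * max 1 (log 2 (real n / real k))) \<and>
      (\<forall>d\<ge>d0. \<forall>I. hamming_indexing_scheme n d c k B (nat \<lceil>real k / \<alpha>\<rceil>) I \<longrightarrow>
         (\<exists>P\<in>point_sets n d.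
            1 * (1 / (2 * exp 1) * sqrt (real n * \<alpha> / (real k * real B))) powr \<alpha> \<le> real (card (I P))))"
    using indexing_scheme_space_bound[OF params(1,2) less_imp_le[OF params(3)] params(4-7)
        \<open>0 < s\<close> \<open>n div k < 2 ^ s\<close>]
    unfolding mult_1 by blast
qed simp_all

end
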